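(* Let $m\geq 2$, $n_1,\ldots,n_m\geq 2$ integers and $N=n_1\cdots n_m$. For every $\sigma\in Sym(m)$, the subgroups $K_{n_1,n_2,\ldots,n_m}$ and $K_{n_{\sigma^{-1}(1)},n_{\sigma^{-1}(2)},\ldots,n_{\sigma^{-1}(m)}}$ of $Sym(\{0,\ldots,N-1\})$ coincide.
   Context: For positive integers $a,b$ and $1\le i\le a$, $1\le j\le b$, $E^{i,j}_{a\times b}$ denotes the $a\times b$ real matrix with entry $1$ in row $i$, column $j$ and $0$ elsewhere; $\otimes$ is the Kronecker product. For integers $k_1,\ldots,k_m\ge 2$ with product $N$ and $\rho\in Sym(m)$, the shuffling matrix is the $N\times N$ permutation matrix $$P^{\rho}_{k_1,\ldots,k_m}=\sum_{\substack{i_j=1,\ldots,k_j\\ j=1,\ldots,m}} E^{i_{\rho^{-1}(1)},i_1}_{k_{\rho^{-1}(1)}\times k_1}\otimes\cdots\otimes E^{i_{\rho^{-1}(m)},i_m}_{k_{\rho^{-1}(m)}\times k_m}.$$ Rows and columns of $N\times N$ matrices are indexed by $\{0,\ldots,N-1\}$; ${\bf e}_x$ is the column vector of length $N$ with $1$ at the position indexed by $x$. The permutation $\widetilde{\rho}$ of $\{0,\ldots,N-1\}$ induced by $P^{\rho}_{k_1,\ldots,k_m}$ is defined by $P^{\rho}_{k_1,\ldots,k_m}{\bf e}_x={\bf e}_{\widetilde{\rho}(x)}$. Define $K_{k_1,\ldots,k_m}=\langle \widetilde{\rho}:\ \rho\in Sym(m)\rangle\le Sym(\{0,\ldots,N-1\})$,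 the group generated by the permutations induced by all shuffling matrices $P^{\rho}_{k_1,\ldots,k_m}$. *)

theory Defs
  imports
    "Jordan_Normal_Form.Matrix"
    "HOL-Algebra.Bij"
    "HOL-Algebra.Generated_Groups"
    "HOL-Combinatorics.Permutations"
begin

text \<open>The mathematical indices \<open>i\<close>, \<open>j\<close> of \<open>E_mat\<close> start at 1; library matrices are indexed from 0.\<close>

definition E_mat :: "nat \<Rightarrow> nat \<Rightarrow> nat \<Rightarrow> nat \<Rightarrow> real mat" where
  "E_mat a b i j = mat a b (\<lambda>(r, c). if Suc r = i \<and> Suc c = j then 1 else 0)"

definition kronecker :: "real mat \<Rightarrow> real mat \<Rightarrow> real mat" where
  "kronecker A B = mat (dim_row A * dim_row B) (dim_col A * dim_col B)
     (\<lambda>(r, c). A $$ (r div dim_row B, c div dim_col B) * B $$ (r mod dim_row B, c mod dim_col B))"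

text \<open>The \<open>1 \<times> 1\<close> identity matrix is neutral for the Kronecker product, so it serves as the
  product of the empty list.\<close>

definition kronecker_list :: "real mat list \<Rightarrow> real mat" where
  "kronecker_list As = foldr kronecker As (1\<^sub>m 1)"

text \<open>A tuple \<open>(k\<^sub>1, \<dots>, k\<^sub>m)\<close> is the restriction of \<open>k :: nat \<Rightarrow> nat\<close> to \<open>{1..m}\<close>; values outside
  are ignored. The inverse of \<open>\<rho>\<close> is written \<open>inv_into UNIV \<rho>\<close> because HOL-Algebra reuses the
  notation \<open>inv\<close>.\<close>

definition shuffle_size :: "nat \<Rightarrow> (nat \<Rightarrow> nat) \<Rightarrow> nat" where
  "shuffle_size m k = (\<Prod>j=1..m. k j)"

definition shuffle_mat :: "nat \<Rightarrow> (nat \<Rightarrow> nat) \<Rightarrow> (nat \<Rightarrow> nat) \<Rightarrow> real mat" where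
  "shuffle_mat m k \<rho> =
     finsum (module_mat TYPE(real) (shuffle_size m k) (shuffle_size m k))
       (\<lambda>i. kronecker_list
              (map (\<lambda>j. E_mat (k (inv_into UNIV \<rho> j)) (k j) (i (inv_into UNIV \<rho> j)) (i j)) [1..<Suc m]))
       (\<Pi>\<^sub>E j\<in>{1..m}. {1..k j})"

definition induced_perm :: "nat \<Rightarrow> real mat \<Rightarrow> nat \<Rightarrow> nat" where
  "induced_perm N P =
     (\<lambda>x\<in>{0..<N}. THE y. y < N \<and> P *\<^sub>v unit_vec N x = unit_vec N y)"

definition shuffle_group :: "nat \<Rightarrow> (nat \<Rightarrow> nat) \<Rightarrow> (nat \<Rightarrow> nat) set" where
  "shuffle_group m k =
     generate (BijGroup {0..<shuffle_size m k})
       {induced_perm (shuffle_size m k) (shuffle_mat m k \<rho>) |\<rho>. \<rho> permutes {1..m}}"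

end

theory Submission
  imports Defs
begin

text \<open>
  Reading tuples as mixed radix numerals, \<open>P\<^sup>\<rho>\<close> sends the number with digits \<open>i\<close> in the bases \<open>k\<close>
  to the number with digits \<open>i \<circ> \<rho>\<^sup>-\<^sup>1\<close> in the bases \<open>k \<circ> \<rho>\<^sup>-\<^sup>1\<close>. Writing \<open>s(k, \<rho>)\<close> for the induced
  permutation, this gives the cocycle identity \<open>s(k, \<tau> \<circ> \<sigma>) = s(k \<circ> \<sigma>\<^sup>-\<^sup>1, \<tau>) \<circ> s(k, \<sigma>)\<close>, so each
  generator \<open>s(k \<circ> \<sigma>\<^sup>-\<^sup>1, \<tau>) = s(k, \<tau> \<circ> \<sigma>) \<circ> s(k, \<sigma>)\<^sup>-\<^sup>1\<close> of the second group lies in the first. The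
  reverse inclusion is the same statement for \<open>\<sigma>\<^sup>-\<^sup>1\<close>.
\<close>

declare upt_Suc [simp del] One_nat_def [simp del]

section \<open>Mixed radix numerals\<close>

text \<open>Digits are counted from 1, as the indices of \<^const>\<open>E_mat\<close> are; the first digit of the list is the
  most significant one.\<close>

primrec radix_value :: "('a \<Rightarrow> nat) \<Rightarrow> ('a \<Rightarrow> nat) \<Rightarrow> 'a list \<Rightarrow> nat" where
  "radix_value k i [] = 0"
| "radix_value k i (j # js) = (i j - 1) * prod_list (map k js) + radix_value k i js"

text \<open>The leading digit contributes at most \<open>k j - 1\<close> copies of the product of
  the remaining bases, and the tail adds less than one further copy.\<close>

lemma radix_value_less:
  assumes "\<forall>j\<in>set js. i j \<in> {1..k j}"
  shows "radix_value k i js < prod_list (map k js)"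
  using assms
proof (induction js)
  case (Cons j js)
  let ?P = "prod_list (map k js)"
  have "radix_value k i (j # js) < (i j - 1) * ?P + ?P"
    using Cons by simp
  also have "\<dots> = i j * ?P"
    using Cons.prems by (cases "i j") auto
  also have "\<dots> \<le> k j * ?P"
    using Cons.prems by (intro mult_right_mono) auto
  finally show ?case by simp
qed simp

lemma div_mod_eq_iff:
  fixes r p c u :: nat
  assumes "u < c"
  shows "r div c = p \<and> r mod c = u \<longleftrightarrow> r = p * c + u"
  using assms by (auto simp: div_mult_mod_eq)

text \<open>Division by the product of the tail bases recovers the leading digit minus 1 as quotient
  and the tail as remainder.\<close>

lemma radix_value_eqD:
  assumes "\<forall>j\<in>set js. i j \<in> {1..k j}" and "\<forall>j\<in>set js. i' j \<in> {1..k j}"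
    and "radix_value k i js = radix_value k i' js" and "j \<in> set js"
  shows "i j = i' j"
  using assms
proof (induction js)
  case (Cons l js)
  let ?P = "prod_list (map k js)"
  have "radix_value k i js < ?P" "radix_value k i' js < ?P"
    using Cons.prems by (auto intro!: radix_value_less)
  with Cons.prems(3) have "i l - 1 = i' l - 1" "radix_value k i js = radix_value k i' js"
    using div_mod_eq_iff[of "radix_value k i js" ?P]
      div_mod_eq_iff[of "radix_value k i' js" ?P] by (metis radix_value.simps(2))+
  \<comment> \<open>Truncated subtraction sends both 0 and 1 to 0, so the lower bound is what lets
    the digits be compared.\<close>
  moreover have "i l \<ge> 1" "i' l \<ge> 1"
    using Cons.prems by auto
  ultimately show ?case
    using Cons by auto
qed simp

text \<open>Injectivity is uniqueness of digits; surjectivity follows by counting, both sets being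
  finite of equal size.\<close>

lemma bij_betw_radix_value:
  assumes "distinct js"
  shows "bij_betw (\<lambda>i. radix_value k i js) (\<Pi>\<^sub>E j\<in>set js. {1..k j}) {0..<\<Prod>j\<in>set js. k j}"
proof -
  let ?I = "\<Pi>\<^sub>E j\<in>set js. {1..k j}" and ?f = "\<lambda>i. radix_value k i js"
  have P: "prod_list (map k js) = (\<Prod>j\<in>set js. k j)"
    using assms by (simp add: prod.distinct_set_conv_list)
  have mem: "\<forall>j\<in>set js. i j \<in> {1..k j}" if "i \<in> ?I" for i
    using that by (auto simp: PiE_iff)
  have inj: "inj_on ?f ?I"
  proof (rule inj_onI)
    fix i i'
    assume ii': "i \<in> ?I" "i' \<in> ?I" and "?f i = ?f i'"
    then show "i = i'"
      by (intro PiE_ext[OF ii'] radix_value_eqD[OF mem[OF ii'(1)] mem[OF ii'(2)]])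
  qed
  have sub: "?f ` ?I \<subseteq> {0..<\<Prod>j\<in>set js. k j}"
    using radix_value_less[OF mem] by (auto simp: P)
  have "card (?f ` ?I) = card {0..<\<Prod>j\<in>set js. k j}"
    unfolding card_image[OF inj] by (simp add: card_PiE)
  with sub have "?f ` ?I = {0..<\<Prod>j\<in>set js. k j}"
    by (intro card_subset_eq) auto
  with inj show ?thesis
    by (simp add: bij_betw_def)
qed

section \<open>Kronecker products and finite sums of matrices\<close>

lemma kronecker_E_mat:
  assumes "u < c" "v < d"
  shows "kronecker (E_mat a b (Suc p) (Suc q)) (E_mat c d (Suc u) (Suc v)) =
    E_mat (a * c) (b * d) (Suc (p * c + u)) (Suc (q * d + v))"
proof (rule eq_matI)
  fix r s
  assume "r < dim_row (E_mat (a * c) (b * d) (Suc (p * c + u)) (Suc (q * d + v)))"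
    and "s < dim_col (E_mat (a * c) (b * d) (Suc (p * c + u)) (Suc (q * d + v)))"
  then have rs: "r < a * c" "s < b * d"
    by (simp_all add: E_mat_def)
  then have "r div c < a" "s div d < b" "r mod c < c" "s mod d < d"
    using assms by (simp_all add: less_mult_imp_div_less)
  \<comment> \<open>Quotients and remainders of \<open>r\<close> and \<open>s\<close> select the
    entries of the two factors; both entries are nonzero exactly when \<open>r = p * c + u\<close>
    and \<open>s = q * d + v\<close>.\<close>
  with rs show "kronecker (E_mat a b (Suc p) (Suc q)) (E_mat c d (Suc u) (Suc v)) $$ (r, s) =
      E_mat (a * c) (b * d) (Suc (p * c + u)) (Suc (q * d + v)) $$ (r, s)"
    using div_mod_eq_iff[OF assms(1), of r p] div_mod_eq_iff[OF assms(2), of s q]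
    by (auto simp: kronecker_def E_mat_def)
qed (simp_all add: kronecker_def E_mat_def)

text \<open>Iterating the two-factor rule builds both indices up as numerals; the empty product is
  the matrix unit at (1, 1), that is, the numeral 0 shifted by \<open>Suc\<close>.\<close>

lemma kronecker_list_E_mat:
  assumes "\<forall>j\<in>set js. x j \<in> {1..a j} \<and> y j \<in> {1..b j}"
  shows "kronecker_list (map (\<lambda>j. E_mat (a j) (b j) (x j) (y j)) js) =
    E_mat (prod_list (map a js)) (prod_list (map b js))
      (Suc (radix_value a x js)) (Suc (radix_value b y js))"
  using assms
proof (induction js)
  case Nil
  show ?case
    by (rule eq_matI) (auto simp: kronecker_list_def E_mat_def)
next
  case (Cons j js)
  have "Suc (x j - 1) = x j" "Suc (y j - 1) = y j"
    using Cons.prems by auto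
  moreover have "radix_value a x js < prod_list (map a js)"
      "radix_value b y js < prod_list (map b js)"
    using Cons.prems by (auto intro!: radix_value_less)
  ultimately show ?case
    using Cons kronecker_E_mat[of "radix_value a x js" "prod_list (map a js)"
        "radix_value b y js" "prod_list (map b js)" "a j" "b j" "x j - 1" "y j - 1"]
    by (simp add: kronecker_list_def)
qed

text \<open>Trades the sum in the abelian group of matrices for ordinary sums of entries.\<close>

lemma finsum_module_mat:
  fixes f :: "'b \<Rightarrow> 'a :: comm_ring_1 mat"
  assumes "finite F" and "f \<in> F \<rightarrow> carrier_mat nr nc"
  shows "finsum (module_mat TYPE('a) nr nc) f F = mat nr nc (\<lambda>rc. \<Sum>x\<in>F. f x $$ rc)"
proof -
  interpret abelian_group "module_mat TYPE('a) nr nc"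
    by (rule abelian_group_mat)
  show ?thesis
    using assms
  proof (induction F)
    case empty
    show ?case
      by (rule eq_matI) (auto simp: module_mat_simps)
  next
    case (insert x F)
    then show ?case
      by (subst finsum_insert) (auto simp: module_mat_simps intro!: eq_matI)
  qed
qed

section \<open>Shuffling matrices acting on unit vectors\<close>

lemma shuffle_size_permute:
  assumes "\<rho> permutes {1..m}"
  shows "shuffle_size m (\<lambda>j. k (inv_into UNIV \<rho> j)) = shuffle_size m k"
  unfolding shuffle_size_def
  using prod.permute[OF permutes_inv[OF assms], of k] by (simp add: o_def)

text \<open>Extensionality survives because the inverse of \<open>\<rho>\<close> fixes every point
  outside \<open>S\<close>.\<close>

lemma PiE_permute:
  assumes "\<rho> permutes S" and "i \<in> (\<Pi>\<^sub>E j\<in>S. A j)"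
  shows "(\<lambda>j. i (inv_into UNIV \<rho> j)) \<in> (\<Pi>\<^sub>E j\<in>S. A (inv_into UNIV \<rho> j))"
  using assms permutes_inv[OF assms(1)]
  by (auto simp: PiE_iff extensional_def permutes_in_image permutes_not_in)

text \<open>Each tuple contributes a single matrix unit, and no two of these share a column, so
  exactly one summand acts on the given unit vector.\<close>

lemma shuffle_mat_unit_vec:
  assumes \<rho>: "\<rho> permutes {1..m}" and i: "i \<in> (\<Pi>\<^sub>E j\<in>{1..m}. {1..k j})"
  shows "shuffle_mat m k \<rho> *\<^sub>v unit_vec (shuffle_size m k) (radix_value k i [1..<Suc m]) =
    unit_vec (shuffle_size m k)
      (radix_value (\<lambda>j. k (inv_into UNIV \<rho> j)) (\<lambda>j. i (inv_into UNIV \<rho> j)) [1..<Suc m])"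
proof -
  let ?N = "shuffle_size m k" and ?I = "\<Pi>\<^sub>E j\<in>{1..m}. {1..k j}" and ?js = "[1..<Suc m]"
  let ?r = "inv_into UNIV \<rho>"
  let ?row = "\<lambda>i. radix_value (\<lambda>j. k (?r j)) (\<lambda>j. i (?r j)) ?js"
  let ?col = "\<lambda>i. radix_value k i ?js"
  have set_js: "set ?js = {1..m}"
    by auto
  have N: "prod_list (map k ?js) = ?N" "prod_list (map (\<lambda>j. k (?r j)) ?js) = ?N"
    using shuffle_size_permute[OF \<rho>, of k] unfolding shuffle_size_def
    by (simp_all only: prod.distinct_set_conv_list[symmetric] distinct_upt set_js)
  have bij: "bij_betw ?col ?I {0..<?N}"
    using bij_betw_radix_value[of ?js k] unfolding set_js shuffle_size_def by simp
  have fin: "finite ?I"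
    by (intro finite_PiE) auto
  have kron: "kronecker_list (map (\<lambda>j. E_mat (k (?r j)) (k j) (i (?r j)) (i j)) ?js) =
      E_mat ?N ?N (Suc (?row i)) (Suc (?col i))" if "i \<in> ?I" for i
    using PiE_permute[OF \<rho> that] that
    by (subst kronecker_list_E_mat) (auto simp only: set_js PiE_iff N)
  have "shuffle_mat m k \<rho> =
      finsum (module_mat TYPE(real) ?N ?N) (\<lambda>i. E_mat ?N ?N (Suc (?row i)) (Suc (?col i))) ?I"
    unfolding shuffle_mat_def
    by (intro abelian_monoid.finsum_cong' abelian_group.axioms(1) abelian_group_mat refl kron)
      (auto simp: module_mat_simps E_mat_def)
  also have "\<dots> = mat ?N ?N (\<lambda>rc. \<Sum>i\<in>?I. E_mat ?N ?N (Suc (?row i)) (Suc (?col i)) $$ rc)"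
    by (intro finsum_module_mat fin) (auto simp: E_mat_def)
  finally have mat: "shuffle_mat m k \<rho> = \<dots>" .
  have col: "?col i < ?N"
    using bij i by (auto dest: bij_betwE)
  show ?thesis
  proof (rule eq_vecI)
    fix r
    assume "r < dim_vec (unit_vec ?N (?row i) :: real vec)"
    then have r: "r < ?N"
      by simp
    have "(shuffle_mat m k \<rho> *\<^sub>v unit_vec ?N (?col i)) $ r = shuffle_mat m k \<rho> $$ (r, ?col i)"
      using r col by (simp add: mat)
    also have "\<dots> = (\<Sum>i'\<in>?I. if r = ?row i' \<and> ?col i = ?col i' then 1 else 0)"
      using r col by (simp add: mat E_mat_def)
    \<comment> \<open>Distinct tuples have distinct column numerals, so only the summand at
      \<open>i\<close> can be nonzero.\<close>
    also have "\<dots> = (\<Sum>i'\<in>?I. if i' = i then if r = ?row i then 1 else 0 else 0)"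
      using bij i by (intro sum.cong) (auto simp: bij_betw_def dest: inj_onD)
    also have "\<dots> = (if r = ?row i then 1 else 0)"
      using fin i by (simp add: sum.delta)
    finally show "(shuffle_mat m k \<rho> *\<^sub>v unit_vec ?N (?col i)) $ r = unit_vec ?N (?row i) $ r"
      using r by (simp add: unit_vec_def)
  qed (simp add: mat)
qed

section \<open>Induced permutations and the cocycle identity\<close>

definition shuffle_perm :: "nat \<Rightarrow> (nat \<Rightarrow> nat) \<Rightarrow> (nat \<Rightarrow> nat) \<Rightarrow> nat \<Rightarrow> nat" where
  "shuffle_perm m k \<rho> = induced_perm (shuffle_size m k) (shuffle_mat m k \<rho>)"

lemma bij_betw_radix_value_shuffle_size:
  "bij_betw (\<lambda>i. radix_value k i [1..<Suc m]) (\<Pi>\<^sub>E j\<in>{1..m}. {1..k j}) {0..<shuffle_size m k}"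
  using bij_betw_radix_value[of "[1..<Suc m]" k]
  by (simp only: distinct_upt set_upt atLeastLessThanSuc_atLeastAtMost shuffle_size_def simp_thms)

lemma radix_value_less_shuffle_size:
  assumes "i \<in> (\<Pi>\<^sub>E j\<in>{1..m}. {1..k j})"
  shows "radix_value k i [1..<Suc m] < shuffle_size m k"
  using bij_betwE[OF bij_betw_radix_value_shuffle_size] assms by auto

lemma radix_value_cases:
  assumes "x < shuffle_size m k"
  obtains i where "i \<in> (\<Pi>\<^sub>E j\<in>{1..m}. {1..k j})" and "x = radix_value k i [1..<Suc m]"
proof -
  have "x \<in> (\<lambda>i. radix_value k i [1..<Suc m]) ` (\<Pi>\<^sub>E j\<in>{1..m}. {1..k j})"
    using bij_betw_imp_surj_on[OF bij_betw_radix_value_shuffle_size] assms by simp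
  then show thesis
    using that by blast
qed

lemma shuffle_perm_radix_value:
  assumes "\<rho> permutes {1..m}" and "i \<in> (\<Pi>\<^sub>E j\<in>{1..m}. {1..k j})"
  shows "shuffle_perm m k \<rho> (radix_value k i [1..<Suc m]) =
    radix_value (\<lambda>j. k (inv_into UNIV \<rho> j)) (\<lambda>j. i (inv_into UNIV \<rho> j)) [1..<Suc m]"
    (is "_ = ?y")
proof -
  let ?N = "shuffle_size m k"
  have x: "radix_value k i [1..<Suc m] < ?N"
    using assms(2) by (rule radix_value_less_shuffle_size)
  have y: "?y < ?N"
    using radix_value_less_shuffle_size[OF PiE_permute[OF assms]]
      shuffle_size_permute[OF assms(1), of k] by simp
  \<comment> \<open>Unit vectors at distinct positions below \<open>?N\<close> differ, so the
    description has a unique solution.\<close>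
  have "(THE y. y < ?N \<and> unit_vec ?N ?y = (unit_vec ?N y :: real vec)) = ?y"
    using y by (intro the_equality) auto
  with x show ?thesis
    by (simp only: shuffle_perm_def induced_perm_def restrict_apply shuffle_mat_unit_vec[OF assms]) simp
qed

text \<open>The cocycle identity: reindexing bases and digits by the inverse of
  \<open>\<sigma>\<close> and then by that of \<open>\<tau>\<close> is reindexing by the inverse of
  \<open>\<tau> \<circ> \<sigma>\<close>.\<close>

lemma shuffle_perm_comp:
  assumes \<sigma>: "\<sigma> permutes {1..m}" and \<tau>: "\<tau> permutes {1..m}" and x: "x < shuffle_size m k"
  shows "shuffle_perm m (\<lambda>j. k (inv_into UNIV \<sigma> j)) \<tau> (shuffle_perm m k \<sigma> x) =
    shuffle_perm m k (\<tau> \<circ> \<sigma>) x"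
proof -
  obtain i where i: "i \<in> (\<Pi>\<^sub>E j\<in>{1..m}. {1..k j})" and "x = radix_value k i [1..<Suc m]"
    using x by (rule radix_value_cases)
  moreover have "inv_into UNIV (\<tau> \<circ> \<sigma>) = inv_into UNIV \<sigma> \<circ> inv_into UNIV \<tau>"
    using \<sigma> \<tau> by (simp add: o_inv_distrib permutes_bij)
  ultimately show ?thesis
    using PiE_permute[OF \<sigma> i]
    by (simp add: shuffle_perm_radix_value \<sigma> \<tau> permutes_compose[OF \<sigma> \<tau>])
qed

lemma shuffle_perm_less:
  assumes \<rho>: "\<rho> permutes {1..m}" and x: "x < shuffle_size m k"
  shows "shuffle_perm m k \<rho> x < shuffle_size m k"
proof -
  obtain i where i: "i \<in> (\<Pi>\<^sub>E j\<in>{1..m}. {1..k j})" and "x = radix_value k i [1..<Suc m]"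
    using x by (rule radix_value_cases)
  then show ?thesis
    using radix_value_less_shuffle_size[OF PiE_permute[OF \<rho> i]] shuffle_size_permute[OF \<rho>, of k]
    by (simp add: shuffle_perm_radix_value[OF \<rho> i])
qed

lemma shuffle_perm_id:
  assumes "x < shuffle_size m k"
  shows "shuffle_perm m k id x = x"
proof -
  obtain i where "i \<in> (\<Pi>\<^sub>E j\<in>{1..m}. {1..k j})" and "x = radix_value k i [1..<Suc m]"
    using assms by (rule radix_value_cases)
  then show ?thesis
    by (simp add: shuffle_perm_radix_value permutes_id)
qed

lemma shuffle_perm_in_carrier:
  assumes \<rho>: "\<rho> permutes {1..m}"
  shows "shuffle_perm m k \<rho> \<in> carrier (BijGroup {0..<shuffle_size m k})"
proof -
  let ?S = "{0..<shuffle_size m k}"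
  have "inj_on (shuffle_perm m k \<rho>) ?S"
  \<comment> \<open>The cocycle identity with \<open>\<tau>\<close> the inverse of
    \<open>\<rho>\<close> supplies a left inverse: the shuffle back from the permuted bases.\<close>
  proof (rule inj_on_inverseI)
    fix x
    assume "x \<in> ?S"
    then show "shuffle_perm m (\<lambda>j. k (inv_into UNIV \<rho> j)) (inv_into UNIV \<rho>) (shuffle_perm m k \<rho> x) = x"
      using shuffle_perm_comp[OF \<rho> permutes_inv[OF \<rho>]]
      by (simp add: permutes_inv_o[OF \<rho>] shuffle_perm_id)
  qed
  moreover have "shuffle_perm m k \<rho> ` ?S \<subseteq> ?S"
    using shuffle_perm_less[OF \<rho>] by auto
  ultimately have "bij_betw (shuffle_perm m k \<rho>) ?S ?S"
    by (simp add: bij_betw_def endo_inj_surj)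
  then show ?thesis
    \<comment> \<open>\<open>Bij\<close> also demands extensionality, which holds because
      \<open>induced_perm\<close> is a restriction.\<close>
    by (simp add: BijGroup_def Bij_def) (simp add: shuffle_perm_def induced_perm_def)
qed

section \<open>The generated groups\<close>

lemma shuffle_group_eq_generate:
  "shuffle_group m k =
    generate (BijGroup {0..<shuffle_size m k}) (shuffle_perm m k ` {\<rho>. \<rho> permutes {1..m}})"
  by (simp add: shuffle_group_def shuffle_perm_def image_Collect)

lemma subgroup_shuffle_group:
  "subgroup (shuffle_group m k) (BijGroup {0..<shuffle_size m k})"
  unfolding shuffle_group_eq_generate
  by (intro group.generate_is_subgroup group_BijGroup) (auto intro: shuffle_perm_in_carrier)

lemma shuffle_perm_in_shuffle_group:
  "\<rho> permutes {1..m} \<Longrightarrow> shuffle_perm m k \<rho> \<in> shuffle_group m k"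
  unfolding shuffle_group_eq_generate by (intro generate.incl) simp

lemma shuffle_group_permute_subset:
  assumes \<sigma>: "\<sigma> permutes {1..m}"
  shows "shuffle_group m (\<lambda>j. k (inv_into UNIV \<sigma> j)) \<subseteq> shuffle_group m k"
proof -
  let ?k' = "\<lambda>j. k (inv_into UNIV \<sigma> j)"
  let ?N = "shuffle_size m k"
  note N = shuffle_size_permute[OF \<sigma>, of k]
  interpret group "BijGroup {0..<?N}"
    by (rule group_BijGroup)
  interpret K: subgroup "shuffle_group m k" "BijGroup {0..<?N}"
    by (rule subgroup_shuffle_group)
  have "shuffle_perm m ?k' \<tau> \<in> shuffle_group m k" if \<tau>: "\<tau> permutes {1..m}" for \<tau>
  proof -
    let ?G = "BijGroup {0..<?N}"
    have c: "shuffle_perm m ?k' \<tau> \<in> carrier ?G" "shuffle_perm m k \<sigma> \<in> carrier ?G"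
        "shuffle_perm m k (\<tau> \<circ> \<sigma>) \<in> carrier ?G"
      using shuffle_perm_in_carrier[OF \<tau>, of ?k'] shuffle_perm_in_carrier[OF \<sigma>]
        shuffle_perm_in_carrier[OF permutes_compose[OF \<sigma> \<tau>]] by (simp_all add: N)
    \<comment> \<open>Both sides are extensional, so agreement below \<open>?N\<close> gives
      equality of functions.\<close>
    have "compose {0..<?N} (shuffle_perm m ?k' \<tau>) (shuffle_perm m k \<sigma>) = shuffle_perm m k (\<tau> \<circ> \<sigma>)"
      using shuffle_perm_comp[OF \<sigma> \<tau>] c(3)
      by (auto simp: fun_eq_iff compose_def BijGroup_def Bij_def extensional_def)
    then have "shuffle_perm m ?k' \<tau> \<otimes>\<^bsub>?G\<^esub> shuffle_perm m k \<sigma> = shuffle_perm m k (\<tau> \<circ> \<sigma>)"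
      using c by (simp add: BijGroup_def)
    then have "shuffle_perm m ?k' \<tau> = shuffle_perm m k (\<tau> \<circ> \<sigma>) \<otimes>\<^bsub>?G\<^esub> inv\<^bsub>?G\<^esub> shuffle_perm m k \<sigma>"
      using c by (metis inv_solve_right)
    then show ?thesis
      using shuffle_perm_in_shuffle_group[OF \<sigma>]
        shuffle_perm_in_shuffle_group[OF permutes_compose[OF \<sigma> \<tau>]] by simp
  qed
  \<comment> \<open>Equal sizes put both groups in the same \<open>BijGroup\<close>, and a subgroup
    containing the generators contains the group they generate.\<close>
  then show ?thesis
    unfolding shuffle_group_eq_generate[of m ?k'] N
    by (intro generate_subgroup_incl subgroup_shuffle_group) auto
qed

theorem theorem4p3:
  fixes m N :: nat and n :: "nat \<Rightarrow> nat" and \<sigma> :: "nat \<Rightarrow> nat"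
  assumes "m \<ge> 2"
    and "\<forall>j\<in>{1..m}. n j \<ge> 2"
    and "N = (\<Prod>j=1..m. n j)"
    and "\<sigma> permutes {1..m}"
  shows "subgroup (shuffle_group m n) (BijGroup {0..<N}) \<and>
    subgroup (shuffle_group m (\<lambda>j. n (inv_into UNIV \<sigma> j))) (BijGroup {0..<N}) \<and>
    shuffle_group m n = shuffle_group m (\<lambda>j. n (inv_into UNIV \<sigma> j))"
proof -
  let ?n' = "\<lambda>j. n (inv_into UNIV \<sigma> j)"
  have N: "N = shuffle_size m n" "N = shuffle_size m ?n'"
    using assms(3) shuffle_size_permute[OF assms(4), of n] by (simp_all add: shuffle_size_def)
  \<comment> \<open>The original tuple is \<open>?n'\<close> permuted by the inverse of
    \<open>\<sigma>\<close>, so the same inclusion also yields the opposite direction.\<close>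
  have "n = (\<lambda>j. ?n' (inv_into UNIV (inv_into UNIV \<sigma>) j))"
    using assms(4) by (simp add: permutes_inv_inv permutes_inverses)
  then have "shuffle_group m n \<subseteq> shuffle_group m ?n'"
    using shuffle_group_permute_subset[OF permutes_inv[OF assms(4)], of ?n'] by simp
  then show ?thesis
    using subgroup_shuffle_group[of m n] subgroup_shuffle_group[of m ?n']
      shuffle_group_permute_subset[OF assms(4), of n] N by auto
qed

end
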